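(* Let $q=p^k$ where $p$ is a prime and $k\ge 1$, and let $m$ be a positive integer with $m\mid q-1$. Let $N(m)$ be the number of conjugacy classes (under conjugation in $\mathrm{GL}(2,q)$) of reducible cyclic subgroups of $\mathrm{GL}(2,q)$ of order $m$. Write the prime decomposition $m=2^{\beta_0}p_1^{\beta_1}\cdots p_r^{\beta_r}$, where $p_1,\dots,p_r$ are distinct odd primes, $\beta_i\ge 1$ for $1\le i\le r$, and $\beta_0\ge 0$. Then $$N(m)=\tfrac12\big(\rho(m)+\delta(m)\big),$$ where $\rho(m)=\prod_{i=0}^{r}\big(p_i^{\beta_i}+p_i^{\beta_i-1}\big)$ with $p_0=2$ if $\beta_0\ge 1$, and $\rho(m)=\prod_{i=1}^{r}\big(p_i^{\beta_i}+p_i^{\beta_i-1}\big)$ if $m$ is odd (empty product $=1$), and $$\delta(m)=\begin{cases}2^{r} & \text{if } 0\le\beta_0\le 1,\\ 2^{r+1} & \text{if } \beta_0=2,\\ 2^{r+2} & \text{if } \beta_0\ge 3.\end{cases}$$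
   Context: A subgroup $H\le \mathrm{GL}(2,q)$ is reducible if the natural module $\mathbb{F}_q^2$ has an $H$-invariant subspace of dimension $1$. $\mathbb{F}_q$ denotes the finite field with $q$ elements. *)

theory Defs
  imports "HOL-Analysis.Finite_Cartesian_Product" "HOL-Computational_Algebra.Primes"
begin

definition GL2 :: "('a::field ^ 2 ^ 2) set" where
  "GL2 = {A. invertible A}"

primrec matpow :: "'a::field ^ 2 ^ 2 \<Rightarrow> nat \<Rightarrow> 'a ^ 2 ^ 2" where
  "matpow A 0 = mat 1"
| "matpow A (Suc n) = A ** matpow A n"

text \<open>The cyclic subgroup generated by g (for g of finite order the submonoid of powers
  equals the subgroup generated).\<close>
definition cyc :: "'a::field ^ 2 ^ 2 \<Rightarrow> ('a ^ 2 ^ 2) set" where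
  "cyc g = {matpow g n | n. True}"

definition cyclic_subgroup_GL2 :: "('a::field ^ 2 ^ 2) set \<Rightarrow> bool" where
  "cyclic_subgroup_GL2 H \<longleftrightarrow> (\<exists>g\<in>GL2. H = cyc g)"

definition reducible :: "('a::field ^ 2 ^ 2) set \<Rightarrow> bool" where
  "reducible H \<longleftrightarrow> (\<exists>v::'a^2. v \<noteq> 0 \<and> (\<forall>h\<in>H. \<exists>c. h *v v = c *s v))"

definition conj_GL2 :: "('a::field ^ 2 ^ 2) set \<Rightarrow> ('a ^ 2 ^ 2) set \<Rightarrow> bool" where
  "conj_GL2 H K \<longleftrightarrow> (\<exists>P\<in>GL2. K = (\<lambda>A. P ** A ** matrix_inv P) ` H)"

definition red_cyc_subgroups :: "nat \<Rightarrow> ('a::field ^ 2 ^ 2) set set" where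
  "red_cyc_subgroups m = {H. cyclic_subgroup_GL2 H \<and> reducible H \<and> card H = m}"

definition N_classes :: "'a::{finite,field} itself \<Rightarrow> nat \<Rightarrow> nat" where
  "N_classes _ m = card ((red_cyc_subgroups m :: ('a ^ 2 ^ 2) set set) //
       {(H, K). H \<in> red_cyc_subgroups m \<and> K \<in> red_cyc_subgroups m \<and> conj_GL2 H K})"

definition rho :: "nat \<Rightarrow> nat" where
  "rho m = (\<Prod>p\<in>prime_factors m. p ^ multiplicity p m + p ^ (multiplicity p m - 1))"

definition delta :: "nat \<Rightarrow> nat" where
  "delta m = (let r = card {p\<in>prime_factors m. odd p}; b = multiplicity (2::nat) m in
     if b \<le> 1 then 2 ^ r else if b = 2 then 2 ^ (r + 1) else 2 ^ (r + 2))"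

end

theory Submission
  imports Defs "HOL-Number_Theory.Totient" "HOL-Algebra.Multiplicative_Group"
    "HOL-Analysis.Determinants"
begin

text \<open>Since \<open>m\<close> is prime to the characteristic, a generator of a reducible cyclic subgroup of order \<open>m\<close>
  is diagonalisable, with eigenvalues powers of a primitive \<open>m\<close>-th root of unity \<open>w\<close>. So the
  subgroup is conjugate to the image, under \<open>(i, j) \<mapsto> diag(w\<^sup>i, w\<^sup>j)\<close>, of a cyclic subgroup of order
  \<open>m\<close> of the square of \<open>\<int>/m\<close>, and two such images are conjugate iff they agree up to swapping the
  coordinates. There are \<open>rho m\<close> such subgroups; the swap-invariant ones are generated by pairs
  \<open>(1, t)\<close> with \<open>t\<^sup>2 = 1\<close>, so there are \<open>delta m\<close> of them, and the orbits of the swap number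
  \<open>(rho m + delta m) / 2\<close>.\<close>

subsection \<open>Multiplicative functions\<close>

text \<open>Reduces the counts of square roots of one and of primitive pairs, and the totient, to
  prime powers.\<close>

lemma multiplicative_eq_prod_prime_powers:
  fixes f :: "nat \<Rightarrow> nat"
  assumes one: "f 1 = 1"
    and mult: "\<And>a b. coprime a b \<Longrightarrow> a > 0 \<Longrightarrow> b > 0 \<Longrightarrow> f (a * b) = f a * f b"
    and "m > 0"
  shows "f m = (\<Prod>p\<in>prime_factors m. f (p ^ multiplicity p m))"
proof -
  \<comment> \<open>Arbitrary finite sets of primes and arbitrary exponents let the induction split
    off one prime at a time.\<close>
  have "f (\<Prod>p\<in>A. p ^ e p) = (\<Prod>p\<in>A. f (p ^ e p))"
    if "finite A" "\<forall>p\<in>A. prime p" for A :: "nat set" and e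
    using that
  proof (induction A rule: finite_induct)
    case (insert p A)
    have "coprime (p ^ e p) (\<Prod>q\<in>A. q ^ e q)"
      using insert by (intro prod_coprime_right) (auto intro: primes_coprime)
    moreover have "p ^ e p > 0" "(\<Prod>q\<in>A. q ^ e q) > 0"
      using insert by (auto intro!: prod_pos dest: prime_gt_0_nat)
    ultimately show ?case using insert by (simp add: mult)
  qed (use one in simp)
  from this[of "prime_factors m" "\<lambda>p. multiplicity p m"] \<open>m > 0\<close> show ?thesis
    by (simp add: prod_prime_factors in_prime_factors_iff)
qed

text \<open>Chinese remainder theorem. Coprimality gives injectivity; surjectivity follows by
  counting, with no congruence to solve.\<close>

lemma bij_betw_mod_pair:
  fixes a b :: nat
  assumes "coprime a b" "a > 0" "b > 0"
  shows "bij_betw (\<lambda>x. (x mod a, x mod b)) {..<a * b} ({..<a} \<times> {..<b})"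
proof -
  have inj: "inj_on (\<lambda>x. (x mod a, x mod b)) {..<a * b}"
  proof (rule inj_onI)
    fix x y assume "x \<in> {..<a * b}" "y \<in> {..<a * b}"
      and "(x mod a, x mod b) = (y mod a, y mod b)"
    moreover from this have "[x = y] (mod a * b)"
      using assms(1) coprime_cong_mult_nat[of x y a b] by (auto simp: cong_def)
    ultimately show "x = y" by (simp add: cong_less_modulus_unique_nat)
  qed
  have "(\<lambda>x. (x mod a, x mod b)) ` {..<a * b} = {..<a} \<times> {..<b}"
    using assms by (intro card_subset_eq) (auto simp: card_image[OF inj])
  with inj show ?thesis by (simp add: bij_betw_def)
qed

lemma card_Collect_mod_mult:
  fixes a b :: nat
  assumes "coprime a b" "a > 0" "b > 0"
    and "\<And>x. P x \<longleftrightarrow> Q (x mod a) \<and> R (x mod b)"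
  shows "card {x. x < a * b \<and> P x} = card {x. x < a \<and> Q x} * card {x. x < b \<and> R x}"
proof -
  note bij = bij_betw_mod_pair[OF assms(1-3)]
  have "bij_betw (\<lambda>x. (x mod a, x mod b)) {x \<in> {..<a * b}. P x}
          {y \<in> {..<a} \<times> {..<b}. Q (fst y) \<and> R (snd y)}"
    by (rule bij_betw_Collect[OF bij]) (simp add: assms(4))
  moreover have "{y \<in> {..<a} \<times> {..<b}. Q (fst y) \<and> R (snd y)} =
      {x. x < a \<and> Q x} \<times> {x. x < b \<and> R x}" by auto
  ultimately show ?thesis
    by (simp add: bij_betw_same_card card_cartesian_product)
qed

subsection \<open>Square roots of one\<close>

text \<open>Least residues represent the classes. For \<open>m = 1\<close> the residue 0 qualifies,
  so the count there is 1, as multiplicativity requires.\<close>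

definition sqrt_one :: "nat \<Rightarrow> nat set" where
  "sqrt_one m = {t. t < m \<and> [t\<^sup>2 = 1] (mod m)}"

lemma card_sqrt_one_mult:
  assumes "coprime a b" "a > 0" "b > 0"
  shows "card (sqrt_one (a * b)) = card (sqrt_one a) * card (sqrt_one b)"
  unfolding sqrt_one_def
proof (rule card_Collect_mod_mult[OF assms])
  fix x
  have "[x\<^sup>2 = 1] (mod a * b) \<longleftrightarrow> [x\<^sup>2 = 1] (mod a) \<and> [x\<^sup>2 = 1] (mod b)"
    using assms(1) coprime_cong_mult_nat cong_modulus_mult_nat
    by (metis mult.commute)
  then show "[x\<^sup>2 = 1] (mod a * b) \<longleftrightarrow> [(x mod a)\<^sup>2 = 1] (mod a) \<and> [(x mod b)\<^sup>2 = 1] (mod b)"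
    by (simp add: cong_def power_mod)
qed

text \<open>Factoring \<open>t^2 - 1\<close> turns the congruence into a divisibility;
  \<open>t > 0\<close> keeps the subtraction on naturals exact.\<close>

lemma mem_sqrt_one_iff:
  assumes "t > 0"
  shows "t \<in> sqrt_one m \<longleftrightarrow> t < m \<and> m dvd (t - 1) * (t + 1)"
proof -
  have "t\<^sup>2 - 1 = (t - 1) * (t + 1)"
    using assms by (cases t) (auto simp: power2_eq_square)
  moreover have "[t\<^sup>2 = 1] (mod m) \<longleftrightarrow> m dvd t\<^sup>2 - 1"
    using assms by (intro cong_altdef_nat) simp
  ultimately show ?thesis by (simp only: sqrt_one_def mem_Collect_eq)
qed

lemma sqrt_one_Suc_0: "sqrt_one (Suc 0) = {0}"
  by (auto simp: sqrt_one_def)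

lemma sqrt_one_pos: "t \<in> sqrt_one m \<Longrightarrow> m > 1 \<Longrightarrow> t > 0"
  by (cases t) (auto simp: sqrt_one_def cong_def)

lemma dvd_less_cases:
  fixes n :: nat
  assumes "n dvd a" "a < 2 * n"
  shows "a = 0 \<or> a = n"
proof -
  from assms obtain k where k: "a = n * k" by auto
  with assms have "k < 2" by (cases "n = 0") auto
  then show ?thesis using k by (auto simp: less_2_cases_iff)
qed

text \<open>The factors \<open>t - 1\<close> and \<open>t + 1\<close> differ by 2, so the odd prime
  \<open>p\<close> divides at most one of them, and that one absorbs all of
  \<open>p ^ e\<close>.\<close>

lemma card_sqrt_one_odd_prime_power:
  assumes p: "prime p" "odd p" and "e > 0"
  shows "card (sqrt_one (p ^ e)) = 2"
proof -
  have "p > 2" using p prime_gt_1_nat[of p] by (cases "p = 2") auto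
  then have gt: "p ^ e > 2" using \<open>e > 0\<close> self_le_power[of p e] by linarith
  have "sqrt_one (p ^ e) = {1, p ^ e - 1}"
  proof (intro equalityI subsetI)
    fix t assume t: "t \<in> sqrt_one (p ^ e)"
    then have tpos: "t > 0" using gt by (auto dest: sqrt_one_pos)
    from t have lt: "t < p ^ e" and dvd: "p ^ e dvd (t - 1) * (t + 1)"
      unfolding mem_sqrt_one_iff[OF tpos] by blast+
    have "\<not> (p dvd t - 1 \<and> p dvd t + 1)"
    proof
      assume "p dvd t - 1 \<and> p dvd t + 1"
      then have "p dvd (t + 1) - (t - 1)" using dvd_diff_nat[of p "t + 1" "t - 1"] by blast
      then have "p dvd 2" using tpos by simp
      then show False using \<open>p > 2\<close> by (auto dest: dvd_imp_le)
    qed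
    then have "coprime (p ^ e) (t - 1) \<or> coprime (p ^ e) (t + 1)"
      using p(1) by (auto intro: prime_imp_coprime)
    then have "p ^ e dvd t + 1 \<or> p ^ e dvd t - 1"
      using dvd coprime_dvd_mult_left_iff[of "p ^ e" "t + 1" "t - 1"]
        coprime_dvd_mult_right_iff[of "p ^ e" "t - 1" "t + 1"] by blast
    then show "t \<in> {1, p ^ e - 1}"
    proof
      assume "p ^ e dvd t + 1"
      from dvd_less_cases[OF this] lt gt show ?thesis by auto
    next
      assume "p ^ e dvd t - 1"
      moreover have "t - 1 < p ^ e" using lt by simp
      ultimately have "t - 1 = 0" using dvd_imp_le by fastforce
      then show ?thesis using tpos by auto
    qed
  next
    fix t assume t: "t \<in> {1, p ^ e - 1}"
    moreover have "p ^ e dvd (p ^ e - 1 - 1) * (p ^ e - 1 + 1)"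
      using gt by (simp only: le_add_diff_inverse2) auto
    ultimately have "p ^ e dvd (t - 1) * (t + 1)" by (elim insertE emptyE) simp_all
    moreover have "t < p ^ e" "t > 0" using t gt by auto
    ultimately show "t \<in> sqrt_one (p ^ e)"
      by (simp only: mem_sqrt_one_iff)
  qed
  moreover have "1 \<noteq> p ^ e - 1" using gt by linarith
  ultimately show ?thesis by simp
qed

lemma card_sqrt_one_2: "card (sqrt_one 2) = 1"
proof -
  have "t \<in> sqrt_one 2 \<longleftrightarrow> t = 1" for t
  proof (cases "t < 2")
    case True
    then have "t = 0 \<or> t = 1" by linarith
    then show ?thesis by (elim disjE) (simp_all add: sqrt_one_def cong_def)
  qed (auto simp: sqrt_one_def)
  then have "sqrt_one 2 = {1}" by blast
  then show ?thesis by simp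
qed

lemma card_sqrt_one_4: "card (sqrt_one 4) = 2"
proof -
  have "t \<in> sqrt_one 4 \<longleftrightarrow> t = 1 \<or> t = 3" for t
  proof (cases "t < 4")
    case True
    then have "t = 0 \<or> t = 1 \<or> t = 2 \<or> t = 3" by linarith
    then show ?thesis by (elim disjE) (simp_all add: sqrt_one_def cong_def)
  qed (auto simp: sqrt_one_def)
  then have "sqrt_one 4 = {1, 3}" by blast
  then show ?thesis by simp
qed

text \<open>Writing \<open>t = 2 * s + 1\<close> gives \<open>4 * s * (s + 1)\<close>, where one of
  \<open>s\<close>, \<open>s + 1\<close> is odd. So \<open>t\<close> is 1 or -1 modulo half the
  modulus, which leaves four residues, distinct because \<open>e >= 3\<close>.\<close>

lemma card_sqrt_one_2_power:
  assumes "e \<ge> 3"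
  shows "card (sqrt_one (2 ^ e)) = 4"
proof -
  obtain d where e: "e = Suc (Suc (Suc d))"
    using assms by (auto dest!: le_Suc_ex simp: numeral_3_eq_3)
  define h :: nat where "h = 2 ^ (e - 1)"
  have h4: "h \<ge> 4" by (simp add: h_def e)
  have pe: "(2::nat) ^ e = 2 * h" by (simp add: h_def e)
  have "even h" by (simp add: h_def e)
  have "sqrt_one (2 ^ e) = {1, 2 * h - 1, h - 1, h + 1}"
  proof (intro equalityI subsetI)
    fix t assume t: "t \<in> sqrt_one (2 ^ e)"
    then have tpos: "t > 0" using h4 pe by (auto dest: sqrt_one_pos)
    from t have lt: "t < 2 * h" and dvd: "2 ^ e dvd (t - 1) * (t + 1)"
      unfolding mem_sqrt_one_iff[OF tpos] by (auto simp: pe)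
    have "even ((t - 1) * (t + 1))" using dvd by (rule dvd_trans[rotated]) (simp add: e)
    then have "odd t" using tpos by auto
    then obtain s where s: "t = 2 * s + 1" by (elim oddE)
    have "(t - 1) * (t + 1) = 4 * (s * (s + 1))" by (simp add: s algebra_simps)
    then have "4 * 2 ^ (e - 2) dvd 4 * (s * (s + 1))" using dvd by (simp add: e)
    then have dvd': "2 ^ (e - 2) dvd s * (s + 1)" by (metis nat_mult_dvd_cancel1 zero_less_numeral)
    have "coprime (2 ^ (e - 2)) s \<or> coprime (2 ^ (e - 2)) (s + 1)"
      by (cases "even s") auto
    then have "2 ^ (e - 2) dvd s + 1 \<or> 2 ^ (e - 2) dvd s"
      using dvd' by (metis coprime_dvd_mult_right_iff coprime_dvd_mult_left_iff)
    then have "2 * 2 ^ (e - 2) dvd 2 * (s + 1) \<or> 2 * 2 ^ (e - 2) dvd 2 * s"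
      by (metis mult_dvd_mono dvd_refl)
    moreover have "2 * 2 ^ (e - 2) = h" by (simp add: h_def e)
    ultimately have "h dvd t + 1 \<or> h dvd t - 1" by (simp add: s)
    then show "t \<in> {1, 2 * h - 1, h - 1, h + 1}"
    proof
      assume "h dvd t + 1"
      then obtain k where k: "t + 1 = h * k" by auto
      \<comment> \<open>Here \<open>t + 1\<close> may equal \<open>2 * h\<close>, so
        \<open>k = 2\<close> has to be allowed; it yields the root \<open>2 * h - 1\<close>.\<close>
      have "h * k < h * 3" using lt h4 k by linarith
      then have "k < 3" by simp
      then have "k = 0 \<or> k = 1 \<or> k = 2" by linarith
      then show ?thesis using k by auto
    next
      assume "h dvd t - 1"
      moreover have "t - 1 < 2 * h" using lt by simp
      ultimately have "t - 1 = 0 \<or> t - 1 = h" by (rule dvd_less_cases)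
      then show ?thesis using tpos by auto
    qed
  next
    fix t assume t: "t \<in> {1, 2 * h - 1, h - 1, h + 1}"
    \<comment> \<open>This form of \<open>h\<close> removes the truncated subtractions and shows
      both products as multiples of \<open>2 * h\<close>.\<close>
    have "\<exists>n. h = 2 * n + 2" using \<open>even h\<close> h4 by presburger
    then obtain n where n: "h = 2 * n + 2" ..
    have "(h + 1 - 1) * (h + 1 + 1) = 2 * h * (n + 2)" "(h - 1 - 1) * (h - 1 + 1) = 2 * h * n"
      by (simp_all add: n)
    then have "2 * h dvd (h + 1 - 1) * (h + 1 + 1)" "2 * h dvd (h - 1 - 1) * (h - 1 + 1)"
      by (simp_all only: dvd_triv_left)
    moreover have "2 * h dvd (1 - 1) * (1 + 1)" "2 * h dvd (2 * h - 1 - 1) * (2 * h - 1 + 1)"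
      using h4 by (simp_all only: le_add_diff_inverse2) auto
    ultimately have "2 * h dvd (t - 1) * (t + 1)" using t by blast
    moreover have "t < 2 * h" "t > 0" using t h4 by auto
    ultimately show "t \<in> sqrt_one (2 ^ e)"
      by (simp only: mem_sqrt_one_iff pe)
  qed
  moreover have "card {1, 2 * h - 1, h - 1, h + 1} = 4"
  proof -
    have "1 \<noteq> 2 * h - 1" "1 \<noteq> h - 1" "1 \<noteq> h + 1" "2 * h - 1 \<noteq> h - 1" "2 * h - 1 \<noteq> h + 1" "h - 1 \<noteq> h + 1"
      using h4 by linarith+
    then have "distinct [1, 2 * h - 1, h - 1, h + 1]"
      by (simp only: distinct.simps list.set insert_iff empty_iff) blast
    from distinct_card[OF this] show ?thesis by (simp only: list.set) simp
  qed
  ultimately show ?thesis by (simp only:)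
qed

lemma card_sqrt_one:
  assumes "m > 0"
  shows "card (sqrt_one m) = delta m"
proof -
  let ?f = "\<lambda>p. card (sqrt_one (p ^ multiplicity p m))"
  let ?O = "{p \<in> prime_factors m. odd p}"
  let ?b = "multiplicity (2::nat) m"
  have mult: "multiplicity p m > 0" if "p \<in> prime_factors m" for p
    using that by (simp add: prime_factors_multiplicity)
  have "card (sqrt_one m) = (\<Prod>p\<in>prime_factors m. ?f p)"
    by (rule multiplicative_eq_prod_prime_powers)
       (use assms in \<open>auto simp: card_sqrt_one_mult sqrt_one_Suc_0\<close>)
  \<comment> \<open>Intersecting with \<open>{2}\<close> treats odd and even \<open>m\<close> alike:
    for odd \<open>m\<close> the second product is empty.\<close>
  also have "\<dots> = prod ?f (?O \<union> (prime_factors m \<inter> {2}))"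
  proof (rule prod.cong)
    have "p = 2" if "prime p" "even p" for p :: nat
      using that primes_dvd_imp_eq two_is_prime_nat by blast
    then show "prime_factors m = ?O \<union> (prime_factors m \<inter> {2})"
      by (auto simp: in_prime_factors_iff)
  qed simp
  also have "\<dots> = (\<Prod>p\<in>?O. ?f p) * (\<Prod>p\<in>prime_factors m \<inter> {2}. ?f p)"
    by (rule prod.union_disjoint) auto
  also have "(\<Prod>p\<in>?O. ?f p) = 2 ^ card ?O"
  proof -
    have "?f p = 2" if "p \<in> ?O" for p
      using that mult[of p] by (auto intro!: card_sqrt_one_odd_prime_power)
    then show ?thesis by (simp add: prod.cong)
  qed
  also have "(\<Prod>p\<in>prime_factors m \<inter> {2}. ?f p) = (if ?b \<le> 1 then 1 else if ?b = 2 then 2 else 4)"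
  proof (cases "2 \<in> prime_factors m")
    case True
    then have "?b > 0" by (rule mult)
    then have "?f 2 = (if ?b \<le> 1 then 1 else if ?b = 2 then 2 else 4)"
      using card_sqrt_one_2 card_sqrt_one_4 card_sqrt_one_2_power[of ?b]
      by (cases "?b = 1") auto
    moreover have "prime_factors m \<inter> {2} = {2}" using True by auto
    ultimately show ?thesis by simp
  next
    case False
    then have "?b = 0" by (simp add: prime_factors_multiplicity)
    then show ?thesis using False by simp
  qed
  finally have "card (sqrt_one m) = 2 ^ card ?O * (if ?b \<le> 1 then 1 else if ?b = 2 then 2 else 4)" .
  moreover have "2 ^ r * (if b \<le> 1 then 1 else if b = 2 then 2 else 4)
      = (if b \<le> 1 then 2 ^ r else if b = 2 then 2 ^ (r + 1) else 2 ^ (r + 2) :: nat)" for r b :: nat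
    by simp
  ultimately show ?thesis by (simp only: delta_def Let_def)
qed

subsection \<open>Primitive pairs\<close>

text \<open>For positive \<open>m\<close> these are the elements of order exactly \<open>m\<close>
  in the square of the integers mod \<open>m\<close>; see \<open>card_orbit_eq_iff\<close>.\<close>

definition prim_pairs :: "nat \<Rightarrow> (nat \<times> nat) set" where
  "prim_pairs m = {(i, j). i < m \<and> j < m \<and> coprime (gcd i j) m}"

lemma finite_prim_pairs [simp]: "finite (prim_pairs m)"
  by (rule finite_subset[of _ "{..<m} \<times> {..<m}"]) (auto simp: prim_pairs_def)

lemma coprime_gcd_mod_iff:
  fixes m x y :: nat
  shows "coprime (gcd (x mod m) (y mod m)) m \<longleftrightarrow> coprime (gcd x y) m"
  unfolding coprime_def gcd_greatest_iff by (meson dvd_mod_iff)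

text \<open>The Chinese remainder bijection acts on both coordinates, and primitivity modulo
  \<open>a * b\<close> splits into primitivity modulo \<open>a\<close> and modulo
  \<open>b\<close>.\<close>

lemma card_prim_pairs_mult:
  assumes "coprime a b" "a > 0" "b > 0"
  shows "card (prim_pairs (a * b)) = card (prim_pairs a) * card (prim_pairs b)"
proof -
  let ?h = "\<lambda>x::nat. (x mod a, x mod b)"
  let ?g = "map_prod ?h ?h"
  note bij = bij_betw_mod_pair[OF assms]
  have "bij_betw ?g ({..<a*b} \<times> {..<a*b}) (({..<a} \<times> {..<b}) \<times> ({..<a} \<times> {..<b}))"
    by (rule bij_betw_map_prod[OF bij bij])
  then have "bij_betw ?g {x \<in> {..<a*b} \<times> {..<a*b}. coprime (gcd (fst x) (snd x)) (a * b)}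
     {y \<in> ({..<a} \<times> {..<b}) \<times> ({..<a} \<times> {..<b}). coprime (gcd (fst (fst y)) (fst (snd y))) a
         \<and> coprime (gcd (snd (fst y)) (snd (snd y))) b}"
    by (rule bij_betw_Collect) (simp add: coprime_gcd_mod_iff split_beta)
  moreover have "{x \<in> {..<a*b} \<times> {..<a*b}. coprime (gcd (fst x) (snd x)) (a * b)} = prim_pairs (a * b)"
    by (auto simp: prim_pairs_def)
  ultimately have "card (prim_pairs (a * b)) =
     card {y \<in> ({..<a} \<times> {..<b}) \<times> ({..<a} \<times> {..<b}). coprime (gcd (fst (fst y)) (fst (snd y))) a
         \<and> coprime (gcd (snd (fst y)) (snd (snd y))) b}"
    by (simp add: bij_betw_same_card)
  \<comment> \<open>Regroups by modulus what the previous bijection grouped by coordinate.\<close>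
  also have "bij_betw (\<lambda>((i, k), (j, l)). ((i, j), (k, l)))
     {y \<in> ({..<a} \<times> {..<b}) \<times> ({..<a} \<times> {..<b}). coprime (gcd (fst (fst y)) (fst (snd y))) a
         \<and> coprime (gcd (snd (fst y)) (snd (snd y))) b} (prim_pairs a \<times> prim_pairs b)"
    by (rule bij_betwI[where g = "\<lambda>((i, j), (k, l)). ((i, k), (j, l))"]) (auto simp: prim_pairs_def)
  then have "card {y \<in> ({..<a} \<times> {..<b}) \<times> ({..<a} \<times> {..<b}). coprime (gcd (fst (fst y)) (fst (snd y))) a
         \<and> coprime (gcd (snd (fst y)) (snd (snd y))) b} = card (prim_pairs a \<times> prim_pairs b)"
    by (rule bij_betw_same_card)
  finally show ?thesis by (simp add: card_cartesian_product)
qed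

text \<open>The pairs left out are those with both entries divisible by \<open>p\<close>. With
  \<open>d = e - 1\<close>, the difference of squares of \<open>p ^ e\<close> and
  \<open>p ^ d\<close> factors, and \<open>p ^ e - p ^ d\<close> is the totient.\<close>

lemma card_prim_pairs_prime_power:
  assumes p: "prime p" and "e > 0"
  shows "card (prim_pairs (p ^ e)) = totient (p ^ e) * (p ^ e + p ^ (e - 1))"
proof -
  obtain d where e: "e = Suc d" using \<open>e > 0\<close> by (cases e) auto
  have ppos: "p > 0" using p prime_gt_0_nat by blast
  let ?Q = "{..<p ^ e} \<times> {..<p ^ e}"
  let ?h = "\<lambda>(i, j). (p * i, p * j)"
  have "coprime (gcd i j) (p ^ e) \<longleftrightarrow> \<not> (p dvd i \<and> p dvd j)" for i j
  proof -
    have "coprime p (gcd i j) \<longleftrightarrow> \<not> p dvd gcd i j"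
      using prime_imp_coprime[OF p, of "gcd i j"] coprime_common_divisor[of p "gcd i j" p]
        not_prime_unit[of p] p by (metis dvd_refl)
    moreover have "coprime (gcd i j) (p ^ e) \<longleftrightarrow> coprime p (gcd i j)"
      using \<open>e > 0\<close> by (simp only: coprime_power_right_iff coprime_commute[of p]) simp
    ultimately show ?thesis by simp
  qed
  then have "prim_pairs (p ^ e) = ?Q - {(i, j) \<in> ?Q. p dvd i \<and> p dvd j}"
    by (auto simp: prim_pairs_def)
  also have "{(i, j) \<in> ?Q. p dvd i \<and> p dvd j} = ?h ` ({..<p ^ d} \<times> {..<p ^ d})"
  proof (intro equalityI subsetI)
    fix x assume "x \<in> {(i, j) \<in> ?Q. p dvd i \<and> p dvd j}"
    then obtain i j where "x = (p * i, p * j)" "p * i < p * p ^ d" "p * j < p * p ^ d"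
      by (auto simp: e elim!: dvdE)
    then show "x \<in> ?h ` ({..<p ^ d} \<times> {..<p ^ d})" by auto
  qed (use ppos in \<open>auto simp: e\<close>)
  finally have "prim_pairs (p ^ e) = ?Q - ?h ` ({..<p ^ d} \<times> {..<p ^ d})" .
  moreover have "?h ` ({..<p ^ d} \<times> {..<p ^ d}) \<subseteq> ?Q" using ppos by (auto simp: e)
  ultimately have "card (prim_pairs (p ^ e)) = card ?Q - card (?h ` ({..<p ^ d} \<times> {..<p ^ d}))"
    by (simp add: card_Diff_subset finite_subset[of _ ?Q])
  also have "card (?h ` ({..<p ^ d} \<times> {..<p ^ d})) = p ^ d * p ^ d"
    using ppos by (subst card_image) (auto simp: inj_on_def)
  also have "card ?Q - p ^ d * p ^ d = (p ^ d * (p - 1)) * (p ^ e + p ^ d)"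
  proof -
    \<comment> \<open>Removes the subtraction \<open>p - 1\<close>, leaving a polynomial identity in
      \<open>n\<close> and \<open>P = p ^ d\<close>.\<close>
    obtain n where n: "p = Suc n" using ppos by (cases p) auto
    have "(Suc n * P) * (Suc n * P) = (P * n) * (Suc n * P + P) + P * P" for P
      by (simp add: algebra_simps)
    from this[of "p ^ d"] show ?thesis by (simp add: e n)
  qed
  finally show ?thesis
    using totient_prime_power_Suc[OF p, of d] by (simp add: e)
qed

text \<open>The left side is Jordan's totient of order two, and \<open>rho\<close> is the Dedekind
  psi function; all the functions involved are multiplicative.\<close>

lemma card_prim_pairs:
  assumes "m > 0"
  shows "card (prim_pairs m) = totient m * rho m"
proof -
  have "prim_pairs 1 = {(0, 0)}" by (auto simp: prim_pairs_def)
  then have "card (prim_pairs m) = (\<Prod>p\<in>prime_factors m. card (prim_pairs (p ^ multiplicity p m)))"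
    by (intro multiplicative_eq_prod_prime_powers)
       (use assms in \<open>auto simp: card_prim_pairs_mult\<close>)
  also have "\<dots> = (\<Prod>p\<in>prime_factors m. totient (p ^ multiplicity p m)
      * (p ^ multiplicity p m + p ^ (multiplicity p m - 1)))"
    by (intro prod.cong refl card_prim_pairs_prime_power) (auto simp: prime_factors_multiplicity)
  also have "\<dots> = (\<Prod>p\<in>prime_factors m. totient (p ^ multiplicity p m)) * rho m"
    by (simp only: rho_def prod.distrib)
  also have "(\<Prod>p\<in>prime_factors m. totient (p ^ multiplicity p m)) = totient m"
    by (rule multiplicative_eq_prod_prime_powers[symmetric])
       (use assms in \<open>auto simp: totient_mult_coprime\<close>)
  finally show ?thesis .
qed

text \<open>The powers of a group element in abstract form: \<open>shift\<close> is cancellation. It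
  serves multiples of a pair, powers of a field element and powers of a matrix.\<close>

lemma range_card_period:
  fixes f :: "nat \<Rightarrow> 'b"
  assumes fin: "finite (range f)"
    and shift: "\<And>i k. f (i + k) = f i \<longleftrightarrow> f k = f 0"
  shows "f i = f j \<longleftrightarrow> [i = j] (mod card (range f))"
proof -
  let ?n = "card (range f)"
  have npos: "?n > 0" using fin by (simp add: card_gt_0_iff)
  \<comment> \<open>Any return to the initial value is a period, so it also bounds the size of the
    range.\<close>
  have mod: "f (i mod d) = f i" if "f d = f 0" for i d
  proof -
    have "f (r + d * k) = f r" for r k
    proof (induction k)
      case (Suc k)
      have "f (r + d * Suc k) = f ((r + d * k) + d)" by (simp add: ac_simps)
      with Suc that shift[of "r + d * k" d] show ?case by simp
    qed simp
    from this[of "i mod d" "i div d"] show ?thesis by simp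
  qed
  have range: "range f = f ` {..<d}" if "f d = f 0" "d > 0" for d
    using mod[OF that(1)] that(2) by (metis (no_types, lifting) image_subset_iff lessThan_iff
        mod_less_divisor rangeI subsetI subset_antisym image_eqI image_mono subset_UNIV)
  \<comment> \<open>Pigeonhole: \<open>?n + 1\<close> indices but \<open>?n\<close> values. The
    coincidence gives a return at \<open>j - i <= ?n\<close>, and the range bound forces
    equality.\<close>
  have "\<not> inj_on f {..?n}"
    using fin by (metis Suc_n_not_le_n card_atMost card_inj_on_le subset_UNIV image_mono)
  then obtain i j where "i < j" "j \<le> ?n" "f i = f j"
    unfolding inj_on_def by (metis atMost_iff linorder_neqE_nat)
  then have d: "f (j - i) = f 0" "0 < j - i" "j - i \<le> ?n"
    using shift[of i "j - i"] by auto
  have "?n \<le> j - i"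
    using range[OF d(1,2)] card_image_le[of "{..<j - i}" f] by simp
  with d have n: "f ?n = f 0" by simp
  have inj: "inj_on f {..<?n}"
    using range[OF n npos] by (intro eq_card_imp_inj_on) auto
  have "f i = f j \<longleftrightarrow> f (i mod ?n) = f (j mod ?n)" for i j by (simp add: mod[OF n])
  also have "\<dots> i j \<longleftrightarrow> i mod ?n = j mod ?n" for i j
    using inj npos by (auto simp: inj_on_def)
  finally show ?thesis by (simp add: cong_def)
qed

subsection \<open>Cyclic subgroups of the square of a cyclic group\<close>

definition scale_pair :: "nat \<Rightarrow> nat \<Rightarrow> nat \<times> nat \<Rightarrow> nat \<times> nat" where
  "scale_pair m n x = (n * fst x mod m, n * snd x mod m)"

text \<open>For positive \<open>m\<close>, the additive cyclic subgroup generated by the pair;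
  natural multiples suffice because the order is finite.\<close>

definition orbit :: "nat \<Rightarrow> nat \<times> nat \<Rightarrow> (nat \<times> nat) set" where
  "orbit m x = range (\<lambda>n. scale_pair m n x)"

lemma orbit_subset: "m > 0 \<Longrightarrow> orbit m x \<subseteq> {..<m} \<times> {..<m}"
  by (auto simp: orbit_def scale_pair_def)

lemma finite_orbit: "m > 0 \<Longrightarrow> finite (orbit m x)"
  using orbit_subset finite_subset by blast

lemma scale_scale: "scale_pair m k (scale_pair m n x) = scale_pair m (k * n) x"
  by (simp add: scale_pair_def mult.assoc mod_mult_right_eq)

lemma scale_cong: "[n = k] (mod m) \<Longrightarrow> scale_pair m n x = scale_pair m k x"
  unfolding scale_pair_def cong_def by (metis mod_mult_left_eq)

lemma scale_one: "x \<in> {..<m} \<times> {..<m} \<Longrightarrow> scale_pair m 1 x = x"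
  by (auto simp: scale_pair_def)

lemma mem_orbit_self: "x \<in> {..<m} \<times> {..<m} \<Longrightarrow> x \<in> orbit m x"
  unfolding orbit_def by (metis scale_one rangeI)

lemma orbit_scale_subset: "orbit m (scale_pair m n x) \<subseteq> orbit m x"
  by (auto simp: orbit_def scale_scale)

lemma prim_pairs_subset: "prim_pairs m \<subseteq> {..<m} \<times> {..<m}"
  by (auto simp: prim_pairs_def)

lemma scale_eq_0_iff: "scale_pair m n x = scale_pair m 0 x \<longleftrightarrow> m dvd n * gcd (fst x) (snd x)"
  by (auto simp: scale_pair_def gcd_mult_distrib_nat mod_eq_0_iff_dvd)

text \<open>The cancellation property that \<open>range_card_period\<close> asks for.\<close>

lemma scale_add_eq_iff: "scale_pair m (i + k) x = scale_pair m i x \<longleftrightarrow> scale_pair m k x = scale_pair m 0 x"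
proof -
  have "(i + k) * z mod m = i * z mod m \<longleftrightarrow> k * z mod m = 0 * z mod m" for z
    using cong_add_lcancel_0_nat[of "i * z" "k * z" m] by (simp add: cong_def add_mult_distrib)
  then show ?thesis by (simp add: scale_pair_def)
qed

lemma scale_eq_iff_card:
  assumes "m > 0"
  shows "scale_pair m i x = scale_pair m j x \<longleftrightarrow> [i = j] (mod card (orbit m x))"
  unfolding orbit_def
  by (rule range_card_period)
     (use finite_orbit[OF assms] scale_add_eq_iff in \<open>simp_all add: orbit_def\<close>)

text \<open>A multiplier \<open>n\<close> kills the pair iff \<open>m\<close> divides
  \<open>n\<close> times the gcd of its entries, so the order is \<open>m\<close> exactly when that
  gcd is prime to \<open>m\<close>.\<close>

lemma card_orbit_eq_iff:
  assumes "m > 0" "x \<in> {..<m} \<times> {..<m}"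
  shows "card (orbit m x) = m \<longleftrightarrow> x \<in> prim_pairs m"
proof -
  let ?g = "gcd (fst x) (snd x)" and ?o = "card (orbit m x)"
  have ord: "?o dvd n \<longleftrightarrow> m dvd n * ?g" for n
    using scale_eq_iff_card[OF assms(1), of n x 0] by (simp add: scale_eq_0_iff cong_0_iff)
  have "?o = m \<longleftrightarrow> coprime ?g m"
  proof
    assume o: "?o = m"
    \<comment> \<open>The quotient \<open>k\<close> already kills the pair; if the order is
      \<open>m\<close>, then \<open>m <= k\<close> and the gcd must be 1.\<close>
    obtain k where k: "m = gcd ?g m * k" by (metis dvdE gcd_dvd2)
    obtain l where l: "?g = gcd ?g m * l" by (metis dvdE gcd_dvd1)
    have "k * ?g = m * l" by (subst l, subst (2) k) (simp add: ac_simps)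
    then have "m dvd k * ?g" by simp
    then have "m dvd k" using ord[of k] o by simp
    moreover have "k > 0" using k assms(1) by (intro Nat.gr0I notI) simp
    ultimately have "m \<le> k" by (simp add: dvd_imp_le)
    then have "gcd ?g m * k \<le> 1 * k" using k by simp
    then have "gcd ?g m \<le> 1" using \<open>k > 0\<close> by (simp only: mult_le_cancel2)
    moreover have "gcd ?g m > 0" using assms(1) by simp
    ultimately have "gcd ?g m = 1" by linarith
    then show "coprime ?g m" by (simp add: coprime_iff_gcd_eq_1)
  next
    assume "coprime ?g m"
    then have "?o dvd n \<longleftrightarrow> m dvd n" for n
      using ord by (simp add: coprime_dvd_mult_left_iff coprime_commute)
    then show "?o = m" by (meson dvd_antisym dvd_refl)
  qed
  then show ?thesis using assms(2) by (auto simp: prim_pairs_def)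
qed

lemma scale_eq_iff:
  assumes "m > 0" "x \<in> prim_pairs m"
  shows "scale_pair m i x = scale_pair m j x \<longleftrightarrow> [i = j] (mod m)"
  using scale_eq_iff_card[OF assms(1), of i x j] card_orbit_eq_iff[OF assms(1), of x]
    assms(2) prim_pairs_subset[of m] by auto

text \<open>Membership gives an inclusion of subgroups, and both have \<open>m\<close>
  elements.\<close>

lemma orbit_eq_iff:
  assumes "m > 0" "x \<in> prim_pairs m" "y \<in> prim_pairs m"
  shows "orbit m y = orbit m x \<longleftrightarrow> y \<in> orbit m x"
proof
  assume "y \<in> orbit m x"
  then obtain n where "y = scale_pair m n x" by (auto simp: orbit_def)
  then have "orbit m y \<subseteq> orbit m x" using orbit_scale_subset by simp
  moreover have "card (orbit m y) = card (orbit m x)"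
    using assms card_orbit_eq_iff prim_pairs_subset by (metis subsetD)
  ultimately show "orbit m y = orbit m x" by (meson assms(1) card_subset_eq finite_orbit)
qed (use assms mem_orbit_self prim_pairs_subset in blast)

section \<open>Generators and the number of cyclic subgroups of order \<open>m\<close>\<close>

lemma scale_mem_prim_pairs_iff:
  assumes "m > 0" "x \<in> prim_pairs m"
  shows "scale_pair m n x \<in> prim_pairs m \<longleftrightarrow> coprime n m"
proof -
  have "coprime (gcd (fst x) (snd x)) m" using assms by (auto simp: prim_pairs_def)
  moreover have "coprime (gcd (n * fst x mod m) (n * snd x mod m)) m
      \<longleftrightarrow> coprime (n * gcd (fst x) (snd x)) m"
    by (simp only: coprime_gcd_mod_iff gcd_mult_distrib_nat)
  ultimately show ?thesis
    using assms by (auto simp: prim_pairs_def scale_pair_def)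
qed

lemma card_orbit_fibre:
  assumes "m > 0" "x \<in> prim_pairs m"
  shows "card {y \<in> prim_pairs m. orbit m y = orbit m x} = totient m"
proof -
  have "{y \<in> prim_pairs m. orbit m y = orbit m x} = (\<lambda>n. scale_pair m n x) ` totatives m"
  proof (intro equalityI subsetI)
    fix y assume "y \<in> {y \<in> prim_pairs m. orbit m y = orbit m x}"
    then have "y \<in> prim_pairs m" "y \<in> orbit m x"
      using assms orbit_eq_iff by blast+
    then obtain n where y: "y = scale_pair m n x" "y \<in> prim_pairs m"
      unfolding orbit_def by blast
    \<comment> \<open>\<open>totatives m\<close> lies in 1 to \<open>m\<close>, so the residue 0 is
      represented by \<open>m\<close>; this case arises only for \<open>m = 1\<close>.\<close>
    define k where "k = (if n mod m = 0 then m else n mod m)"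
    have "[k = n] (mod m)" by (simp add: k_def cong_def)
    then have "y = scale_pair m k x" using y scale_cong by metis
    moreover from this y have "coprime k m" using assms scale_mem_prim_pairs_iff by metis
    then have "k \<in> totatives m" using assms(1)
      by (auto simp: in_totatives_iff k_def less_imp_le)
    ultimately show "y \<in> (\<lambda>n. scale_pair m n x) ` totatives m" by blast
  next
    fix y assume "y \<in> (\<lambda>n. scale_pair m n x) ` totatives m"
    then obtain n where "y = scale_pair m n x" "coprime n m" by (auto simp: in_totatives_iff)
    then show "y \<in> {y \<in> prim_pairs m. orbit m y = orbit m x}"
      using assms by (simp add: scale_mem_prim_pairs_iff orbit_eq_iff) (simp add: orbit_def)
  qed
  moreover have "inj_on (\<lambda>n. scale_pair m n x) (totatives m)"
  proof (rule inj_onI)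
    fix n k assume "n \<in> totatives m" "k \<in> totatives m" "scale_pair m n x = scale_pair m k x"
    then have "[n = k] (mod m)" "0 < n" "n \<le> m" "0 < k" "k \<le> m"
      using assms by (auto simp: scale_eq_iff in_totatives_iff)
    then show "n = k"
      by (cases "n = m"; cases "k = m") (auto simp: cong_def)
  qed
  ultimately show ?thesis by (simp add: card_image totient_def)
qed

text \<open>Each subgroup has \<open>totient m\<close> generators, so dividing the number of
  primitive pairs by it counts the subgroups.\<close>

lemma card_orbits:
  assumes "m > 0"
  shows "card (orbit m ` prim_pairs m) = rho m"
proof -
  have "card (prim_pairs m) = (\<Sum>c\<in>orbit m ` prim_pairs m. card {x \<in> prim_pairs m. orbit m x = c})"
    using sum.image_gen[of "prim_pairs m" "\<lambda>_. 1::nat" "orbit m"] by simp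
  also have "\<dots> = (\<Sum>c\<in>orbit m ` prim_pairs m. totient m)"
    using card_orbit_fibre[OF assms] by (intro sum.cong) auto
  finally show ?thesis using card_prim_pairs[OF assms] assms by simp
qed

section \<open>The coordinate swap on subgroups\<close>

lemma swap_scale: "prod.swap (scale_pair m n x) = scale_pair m n (prod.swap x)"
  by (simp add: scale_pair_def)

lemma swap_orbit: "prod.swap ` orbit m x = orbit m (prod.swap x)"
  by (simp add: orbit_def image_image swap_scale)

lemma swap_mem_prim_pairs: "x \<in> prim_pairs m \<Longrightarrow> prod.swap x \<in> prim_pairs m"
  by (auto simp: prim_pairs_def gcd.commute)

text \<open>If \<open>(j, i) = n (i, j)\<close> then \<open>i\<close> must be a unit, so a swap-invariant subgroup is generated
  by a pair \<open>(1, t)\<close> with \<open>t\<^sup>2 = 1\<close>.\<close>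
lemma card_swap_fixed_orbits:
  assumes "m > 0"
  shows "card {c \<in> orbit m ` prim_pairs m. prod.swap ` c = c} = card (sqrt_one m)"
proof -
  \<comment> \<open>With \<open>1 mod m\<close> instead of 1 the pair stays reduced even for
    \<open>m = 1\<close>.\<close>
  define u where "u t = (1 mod m, t)" for t :: nat
  have u_prim: "u t \<in> prim_pairs m" if "t < m" for t
  proof -
    have "coprime (gcd 1 t) m" by simp
    then have "coprime (gcd (1 mod m) (t mod m)) m" by (simp only: coprime_gcd_mod_iff)
    then show ?thesis using that assms by (auto simp: u_def prim_pairs_def)
  qed
  have scale_u: "scale_pair m n (u t) = (n mod m, n * t mod m)" for n t
    by (simp add: scale_pair_def u_def mod_mult_right_eq[of n 1 m, simplified])
  have "{c \<in> orbit m ` prim_pairs m. prod.swap ` c = c} = (\<lambda>t. orbit m (u t)) ` sqrt_one m"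
  proof (intro equalityI subsetI)
    fix c assume "c \<in> {c \<in> orbit m ` prim_pairs m. prod.swap ` c = c}"
    then obtain x where x: "x \<in> prim_pairs m" "c = orbit m x" "orbit m (prod.swap x) = orbit m x"
      by (auto simp: swap_orbit)
    obtain i j where ij: "x = (i, j)" by (cases x)
    from x(1) ij have lt: "i < m" "j < m" and cop: "coprime (gcd i j) m"
      by (auto simp: prim_pairs_def)
    have "prod.swap x \<in> orbit m x"
      using x assms orbit_eq_iff swap_mem_prim_pairs by blast
    then obtain n where n: "j = n * i mod m" "i = n * j mod m"
      by (auto simp: orbit_def scale_pair_def ij)
    \<comment> \<open>A common divisor of \<open>i\<close> and \<open>m\<close> divides
      \<open>j\<close>, a multiple of \<open>i\<close> modulo \<open>m\<close>, which contradicts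
      primitivity.\<close>
    have "coprime i m"
    proof (rule coprimeI)
      fix d assume "d dvd i" "d dvd m"
      moreover from this have "d dvd j" using n(1) by (simp add: dvd_mod_iff)
      ultimately have "d dvd gcd i j" by simp
      then show "is_unit d" using cop \<open>d dvd m\<close> coprime_common_divisor by blast
    qed
    define t where "t = n mod m"
    have "x = scale_pair m i (u t)"
      unfolding scale_u using lt n(1) by (simp add: ij t_def mod_mult_right_eq mult.commute)
    moreover have "t < m" using assms by (simp add: t_def)
    ultimately have "c = orbit m (u t)"
      using x(1,2) assms u_prim orbit_eq_iff by (metis orbit_def rangeI)
    moreover have "t \<in> sqrt_one m"
    proof -
      \<comment> \<open>Swapping twice multiplies \<open>i\<close> by \<open>n^2\<close> and returns
        \<open>i\<close>; the unit \<open>i\<close> then cancels.\<close>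
      have "[i * n\<^sup>2 = n * (n * i mod m)] (mod m)"
        by (simp add: cong_def mod_mult_right_eq power2_eq_square ac_simps)
      also have "[n * (n * i mod m) = i * 1] (mod m)"
        using n lt(1) by (simp add: cong_def)
      finally have "[n\<^sup>2 = 1] (mod m)"
        using \<open>coprime i m\<close> by (simp only: cong_mult_lcancel_nat)
      then show ?thesis using \<open>t < m\<close> by (simp add: sqrt_one_def t_def cong_def power_mod)
    qed
    ultimately show "c \<in> (\<lambda>t. orbit m (u t)) ` sqrt_one m" by blast
  next
    fix c assume "c \<in> (\<lambda>t. orbit m (u t)) ` sqrt_one m"
    then obtain t where t: "c = orbit m (u t)" "t < m" "[t\<^sup>2 = 1] (mod m)"
      by (auto simp: sqrt_one_def)
    have "prod.swap (u t) = scale_pair m t (u t)"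
      using t(2,3) unfolding scale_u by (simp add: u_def cong_def power2_eq_square)
    then have "orbit m (prod.swap (u t)) = orbit m (u t)"
      using t(2) assms u_prim orbit_eq_iff swap_mem_prim_pairs by (metis orbit_def rangeI)
    then show "c \<in> {c \<in> orbit m ` prim_pairs m. prod.swap ` c = c}"
      using t u_prim by (auto simp: swap_orbit)
  qed
  moreover have "inj_on (\<lambda>t. orbit m (u t)) (sqrt_one m)"
  proof (rule inj_onI)
    fix s t assume st: "s \<in> sqrt_one m" "t \<in> sqrt_one m" "orbit m (u s) = orbit m (u t)"
    then have lt: "s < m" "t < m" by (auto simp: sqrt_one_def)
    then have "u s \<in> orbit m (u t)" using st(3) assms u_prim orbit_eq_iff by blast
    then obtain n where n: "u s = scale_pair m n (u t)" by (auto simp: orbit_def)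
    \<comment> \<open>The first coordinate forces the multiplier to be 1, so different
      \<open>t\<close> give different subgroups.\<close>
    then have "1 mod m = n mod m" "s = n * t mod m" unfolding scale_u by (auto simp: u_def)
    then have "s = 1 * t mod m" by (metis mod_mult_left_eq)
    then show "s = t" using lt by simp
  qed
  ultimately show ?thesis by (simp add: card_image)
qed

subsection \<open>Classes under an involution\<close>

text \<open>Every class meets \<open>X\<close> in some \<open>{x, s x}\<close>. Giving fixed points
  weight 2 and other points weight 1 makes each class weigh 2.\<close>

lemma card_quotient_involution:
  assumes eq: "equiv A r" and "finite X" "X \<subseteq> A"
    and rep: "\<And>a. a \<in> A \<Longrightarrow> \<exists>x\<in>X. (a, x) \<in> r"
    and s: "\<And>x. x \<in> X \<Longrightarrow> s x \<in> X" "\<And>x. x \<in> X \<Longrightarrow> s (s x) = x"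
    and r: "\<And>x y. x \<in> X \<Longrightarrow> y \<in> X \<Longrightarrow> (x, y) \<in> r \<longleftrightarrow> y = x \<or> y = s x"
  shows "2 * card (A // r) = card X + card {x \<in> X. s x = x}"
proof -
  define f where "f x = r `` {x}" for x
  define h :: "_ \<Rightarrow> nat" where "h x = 1 + (if s x = x then 1 else 0)" for x
  have "A // r = f ` X"
    using rep \<open>X \<subseteq> A\<close> equiv_class_eq[OF eq]
    by (fastforce simp: quotient_def f_def)
  have fibre: "{y \<in> X. f y = f x} = {x, s x}" if "x \<in> X" for x
  proof -
    have "f y = f x \<longleftrightarrow> (x, y) \<in> r" if "y \<in> X" for y
      using eq_equiv_class_iff[OF eq, of x y] that \<open>x \<in> X\<close> \<open>X \<subseteq> A\<close> by (auto simp: f_def)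
    then show ?thesis using r that s by auto
  qed
  have "sum h X = (\<Sum>c\<in>f ` X. sum h {x \<in> X. f x = c})"
    by (rule sum.image_gen[OF \<open>finite X\<close>])
  also have "\<dots> = (\<Sum>c\<in>f ` X. 2)"
  proof (rule sum.cong)
    fix c assume "c \<in> f ` X"
    then obtain x where x: "x \<in> X" "c = f x" by blast
    then show "sum h {x \<in> X. f x = c} = 2"
      using s(2)[of x] by (cases "s x = x") (auto simp: fibre h_def)
  qed simp
  also have "\<dots> = 2 * card (A // r)" using \<open>A // r = f ` X\<close> by simp
  also have "sum h X = card X + card {x \<in> X. s x = x}"
    unfolding h_def sum.distrib using \<open>finite X\<close> by (simp add: sum.If_cases Int_def)
  finally show ?thesis by simp
qed

subsection \<open>Roots of unity in a finite field\<close>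

text \<open>Packages the field type as an explicit ring structure, to which the cyclicity of the
  multiplicative group of a finite field applies.\<close>

lemma finite_field_generator:
  obtains g :: "'a::{finite,field}" where "g \<noteq> 0" "range (\<lambda>i. g ^ i) = UNIV - {0}"
proof -
  define R :: "'a ring" where
    "R = \<lparr>carrier = UNIV, monoid.mult = (*), one = 1, ring.zero = 0, add = (+)\<rparr>"
  have "\<exists>y. x + y = 0" "\<exists>y. y + x = 0" for x :: 'a by (metis add.right_inverse add.left_inverse)+
  moreover have "x \<noteq> 0 \<Longrightarrow> \<exists>y. x * y = 1" "x \<noteq> 0 \<Longrightarrow> \<exists>y. y * x = 1" for x :: 'a
    by (metis right_inverse left_inverse)+
  ultimately interpret R: Ring.field R
    unfolding R_def by unfold_locales (auto simp: algebra_simps Units_def)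
  have pow: "x [^]\<^bsub>R\<^esub> (n::nat) = x ^ n" for x n
    by (induction n) (simp_all add: R_def nat_pow_def mult.commute)
  have "carrier (mult_of R) = UNIV - {0}" by (simp add: R_def)
  moreover have "finite (carrier R)" by simp
  from R.finite_field_mult_group_has_gen[OF this]
  obtain g where "g \<in> carrier (mult_of R)"
    "carrier (mult_of R) = {g [^]\<^bsub>R\<^esub> i | i::nat. i \<in> UNIV}" by (auto simp: nat_pow_mult_of)
  ultimately show ?thesis by (intro that[of g]) (auto simp: pow)
qed

text \<open>With \<open>g\<close> a generator of the multiplicative group, take
  \<open>w = g ^ l\<close> where \<open>l\<close> is \<open>(CARD('a) - 1) / m\<close>.\<close>

lemma primitive_root_of_unity:
  assumes "m > 0" "m dvd CARD('a) - 1"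
  obtains w :: "'a::{finite,field}" where "w \<noteq> 0" "\<And>i j. w ^ i = w ^ j \<longleftrightarrow> [i = j] (mod m)"
    "\<And>a. a ^ m = 1 \<Longrightarrow> \<exists>i<m. a = w ^ i"
proof -
  obtain g :: 'a where g: "g \<noteq> 0" "range (\<lambda>i. g ^ i) = UNIV - {0}"
    by (rule finite_field_generator)
  have card: "card (range (\<lambda>i. g ^ i)) = CARD('a) - 1" by (simp add: g(2))
  have ord: "g ^ i = g ^ j \<longleftrightarrow> [i = j] (mod (CARD('a) - 1))" for i j
    unfolding card[symmetric] by (rule range_card_period) (auto simp: power_add g(1))
  obtain l where l: "CARD('a) - 1 = l * m" using assms(2) by (metis dvdE mult.commute)
  \<comment> \<open>The field has at least two elements, so \<open>l\<close> cannot be 0.\<close>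
  have "card {0, 1 :: 'a} \<le> CARD('a)" by (intro card_mono) auto
  then have "l > 0" using l by (cases l) auto
  have w: "(g ^ l) ^ i = (g ^ l) ^ j \<longleftrightarrow> [i = j] (mod m)" for i j
    using \<open>l > 0\<close> unfolding power_mult[symmetric] ord l
    by (simp add: cong_def mult_mod_right[symmetric])
  show ?thesis
  proof (rule that[of "g ^ l"])
    fix a :: 'a assume a: "a ^ m = 1"
    then have "a \<noteq> 0" using assms(1) by (auto simp: power_0_left)
    then obtain k where k: "a = g ^ k" using g(2) by blast
    then have "g ^ (k * m) = g ^ 0" using a by (simp add: power_mult)
    then have "l * m dvd k * m" using ord l by (simp only: cong_0_iff)
    then have "l dvd k" using assms(1) by simp
    then obtain t where "k = l * t" ..
    then have "a = (g ^ l) ^ t" using k by (simp add: power_mult)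
    also have "\<dots> = (g ^ l) ^ (t mod m)" using w[of t "t mod m"] by (simp add: cong_def)
    finally show "\<exists>i<m. a = (g ^ l) ^ i" using assms(1) mod_less_divisor by blast
  qed (use g w in auto)
qed

lemma of_nat_dvd_card_minus_one_nonzero:
  assumes "m dvd CARD('a) - 1"
  shows "(of_nat m :: 'a::{finite,field}) \<noteq> 0"
proof
  assume m: "(of_nat m :: 'a) = 0"
  obtain l where l: "CARD('a) - 1 = m * l" using assms by auto
  \<comment> \<open>Translation by 1 permutes the field, so the sum of all elements is unchanged and
    the field size is 0 in the field; yet that size is 1 modulo \<open>m\<close>.\<close>
  have "(\<Sum>x\<in>(UNIV::'a set). x) = (\<Sum>x\<in>UNIV. x + 1)"
    by (rule sum.reindex_bij_witness[of _ "\<lambda>x. x + 1" "\<lambda>x. x - 1"]) auto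
  then have "(of_nat CARD('a) :: 'a) = 0" by (simp add: sum.distrib)
  moreover have "CARD('a) = m * l + 1"
    using l by (metis Suc_eq_plus1 Suc_pred' zero_less_card_finite)
  then have "(of_nat CARD('a) :: 'a) = 1" using m by simp
  ultimately show False by simp
qed

subsection \<open>Conjugation of cyclic matrix groups\<close>

lemma matrix_inv_mult:
  fixes P :: "'a::field ^ 'n ^ 'n"
  assumes "invertible P"
  shows "P ** matrix_inv P = mat 1" "matrix_inv P ** P = mat 1"
  using assms someI_ex[of "\<lambda>B. P ** B = mat 1 \<and> B ** P = mat 1"]
  by (auto simp: invertible_def matrix_inv_def)

lemma matrix_inv_cancel:
  fixes P :: "'a::field ^ 'n ^ 'n"
  assumes "invertible P"
  shows "P ** (matrix_inv P ** A) = A" "matrix_inv P ** (P ** A) = A"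
    "A ** P ** matrix_inv P = A" "A ** matrix_inv P ** P = A"
  by (simp_all add: matrix_mul_assoc matrix_inv_mult[OF assms])
     (simp_all add: matrix_mul_assoc[symmetric] matrix_inv_mult[OF assms])

lemma matrix_inv_unique:
  fixes P :: "'a::field ^ 'n ^ 'n"
  assumes "P ** Q = mat 1" "Q ** P = mat 1"
  shows "matrix_inv P = Q"
proof -
  have "invertible P" using assms by (auto simp: invertible_def)
  then show ?thesis using assms matrix_inv_cancel(2)[of P Q] by simp
qed

lemma invertible_matrix_inv:
  fixes P :: "'a::field ^ 'n ^ 'n"
  assumes "invertible P"
  shows "invertible (matrix_inv P)"
  using matrix_inv_mult[OF assms] unfolding invertible_def by blast

text \<open>Lets conjugations be checked by entries without computing an inverse.\<close>

lemma matrix_conj_eq_iff: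
  fixes P :: "'a::field ^ 'n ^ 'n"
  assumes "invertible P"
  shows "P ** A ** matrix_inv P = B \<longleftrightarrow> P ** A = B ** P"
  using matrix_inv_cancel(3,4)[OF assms] by metis

lemma matrix_conj_inj:
  fixes P :: "'a::field ^ 'n ^ 'n"
  assumes "invertible P"
  shows "inj (\<lambda>A. P ** A ** matrix_inv P)"
  by (rule inj_on_inverseI[where g = "\<lambda>B. matrix_inv P ** (B ** P)"])
     (simp add: matrix_inv_cancel[OF assms])

lemma matpow_add: "matpow A (m + n) = matpow A m ** matpow A n"
  by (induction m) (simp_all add: matrix_mul_assoc)

lemma matpow_conj:
  assumes "invertible P"
  shows "matpow (P ** A ** matrix_inv P) n = P ** matpow A n ** matrix_inv P"
proof (induction n)
  case (Suc n)
  have "P ** A ** matrix_inv P ** (P ** matpow A n ** matrix_inv P)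
      = P ** A ** (matrix_inv P ** (P ** (matpow A n ** matrix_inv P)))"
    by (simp add: matrix_mul_assoc)
  with Suc show ?case by (simp add: matrix_inv_cancel[OF assms] matrix_mul_assoc)
qed (simp add: matrix_inv_mult[OF assms])

lemma invertible_matpow: "invertible A \<Longrightarrow> invertible (matpow A n)"
  by (induction n) (auto simp: invertible_mult invertible_def[of "mat 1"])

lemma cyc_eq_range: "cyc g = range (matpow g)"
  by (auto simp: cyc_def)

lemma cyc_conj:
  "invertible P \<Longrightarrow> (\<lambda>A. P ** A ** matrix_inv P) ` cyc g = cyc (P ** g ** matrix_inv P)"
  by (simp add: cyc_eq_range image_image matpow_conj)

lemma mem_cyc_self: "g \<in> cyc g"
  unfolding cyc_eq_range by (rule range_eqI[of _ _ 1]) simp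

text \<open>The powers of \<open>g\<close> satisfy cancellation, so the size of their range is a
  period.\<close>

lemma matpow_card_cyc:
  fixes g :: "'a::{finite,field} ^ 2 ^ 2"
  assumes "invertible g"
  shows "matpow g (card (cyc g)) = mat 1"
proof -
  have "matpow g (i + k) = matpow g i \<longleftrightarrow> matpow g k = matpow g 0" for i k
    using matrix_inv_cancel(2)[OF invertible_matpow[OF assms, of i]]
    by (metis matpow_add add_0_right)
  from range_card_period[of "matpow g", OF _ this, of "card (cyc g)" 0] show ?thesis
    by (simp add: cyc_eq_range cong_0_iff)
qed

lemma conj_GL2_refl: "conj_GL2 H H"
proof -
  have "matrix_inv (mat 1) = (mat 1 :: 'a ^ 2 ^ 2)" by (rule matrix_inv_unique) simp_all
  then show ?thesis unfolding conj_GL2_def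
    by (intro bexI[of _ "mat 1"]) (auto simp: GL2_def invertible_def)
qed

lemma conj_GL2_sym:
  assumes "conj_GL2 H K"
  shows "conj_GL2 K H"
proof -
  obtain P where P: "invertible P" "K = (\<lambda>A. P ** A ** matrix_inv P) ` H"
    using assms by (auto simp: conj_GL2_def GL2_def)
  have "matrix_inv (matrix_inv P) = P"
    by (rule matrix_inv_unique) (simp_all add: matrix_inv_mult P)
  moreover have "matrix_inv P ** (P ** A ** matrix_inv P) ** P = A" for A
    by (simp only: matrix_mul_assoc[symmetric] matrix_inv_cancel(2)[OF P(1)] matrix_inv_mult[OF P(1)]
        matrix_mul_rid)
  ultimately show ?thesis unfolding conj_GL2_def
    using invertible_matrix_inv[OF P(1)]
    by (intro bexI[of _ "matrix_inv P"]) (simp_all add: GL2_def P(2) image_image)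
qed

lemma conj_GL2_trans:
  assumes "conj_GL2 H K" "conj_GL2 K L"
  shows "conj_GL2 H L"
proof -
  obtain P where P: "invertible P" "K = (\<lambda>A. P ** A ** matrix_inv P) ` H"
    using assms by (auto simp: conj_GL2_def GL2_def)
  obtain Q where Q: "invertible Q" "L = (\<lambda>A. Q ** A ** matrix_inv Q) ` K"
    using assms by (auto simp: conj_GL2_def GL2_def)
  have "matrix_inv (Q ** P) = matrix_inv P ** matrix_inv Q"
    by (rule matrix_inv_unique)
       (simp_all add: matrix_mul_assoc[symmetric] matrix_inv_cancel P(1) Q(1) matrix_inv_mult)
  then have "L = (\<lambda>A. (Q ** P) ** A ** matrix_inv (Q ** P)) ` H"
    by (simp add: P(2) Q(2) image_image matrix_mul_assoc)
  then show ?thesis unfolding conj_GL2_def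
    using P(1) Q(1) by (intro bexI[of _ "Q ** P"]) (simp_all add: GL2_def invertible_mult)
qed

subsection \<open>Diagonalisation of two by two matrices\<close>

abbreviation mat2 :: "'a::field \<Rightarrow> 'a \<Rightarrow> 'a \<Rightarrow> 'a \<Rightarrow> 'a ^ 2 ^ 2" where
  "mat2 a b c d \<equiv> vector [vector [a, b], vector [c, d]]"

abbreviation diag2 :: "'a::field \<Rightarrow> 'a \<Rightarrow> 'a ^ 2 ^ 2" where
  "diag2 a b \<equiv> mat2 a 0 0 b"

lemma mat2_eq_iff:
  fixes A B :: "'a ^ 2 ^ 2"
  shows "A = B \<longleftrightarrow> A$1$1 = B$1$1 \<and> A$1$2 = B$1$2 \<and> A$2$1 = B$2$1 \<and> A$2$2 = B$2$2"
  by (auto simp: vec_eq_iff forall_2)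

lemma mat2_mult_nth:
  fixes A B :: "'a::field ^ 2 ^ 2"
  shows "(A ** B)$i$j = A$i$1 * B$1$j + A$i$2 * B$2$j"
  by (simp add: matrix_matrix_mult_def sum_2)

lemma mat2_one: "mat 1 = (diag2 1 1 :: 'a::field ^ 2 ^ 2)"
  by (simp add: mat2_eq_iff mat_def)

lemma diag2_eq_iff: "diag2 a b = diag2 c d \<longleftrightarrow> a = c \<and> b = d"
  by (simp add: mat2_eq_iff)

lemma invertible_mat2_iff:
  fixes P :: "'a::field ^ 2 ^ 2"
  shows "invertible P \<longleftrightarrow> P$1$1 * P$2$2 - P$1$2 * P$2$1 \<noteq> 0"
  by (simp add: invertible_det_nz det_2)

lemma matpow_diag2: "matpow (diag2 a b) n = diag2 (a ^ n) (b ^ n)"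
  by (induction n) (simp_all add: mat2_one, simp add: mat2_eq_iff mat2_mult_nth)

text \<open>At \<open>n = 0\<close> the truncated exponent is harmless, since its coefficient
  \<open>of_nat n\<close> vanishes.\<close>

lemma matpow_jordan: "matpow (mat2 a x 0 a) n = mat2 (a ^ n) (of_nat n * a ^ (n - 1) * x) 0 (a ^ n)"
proof (induction n)
  case (Suc n)
  have "a * (of_nat n * a ^ (n - 1) * x) = of_nat n * a ^ n * x"
    by (cases n) (simp_all add: mult.assoc mult.left_commute)
  with Suc show ?case by (simp add: mat2_eq_iff mat2_mult_nth algebra_simps)
qed (simp add: mat2_one mat2_eq_iff)

text \<open>The eigenvector becomes the first column of \<open>P\<close>; a standard basis vector
  independent of it becomes the second.\<close>

lemma triangularise:
  fixes g :: "'a::field ^ 2 ^ 2"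
  assumes v: "v \<noteq> 0" and gv: "g *v v = c *s v"
  obtains P x b where "invertible P" "g ** P = P ** mat2 c x 0 b"
proof -
  have e: "g$1$1 * v$1 + g$1$2 * v$2 = c * v$1" "g$2$1 * v$1 + g$2$2 * v$2 = c * v$2"
    using arg_cong[OF gv, of "\<lambda>u. u$1"] arg_cong[OF gv, of "\<lambda>u. u$2"]
    by (simp_all add: matrix_vector_mult_def sum_2)
  show ?thesis
  proof (cases "v$1 = 0")
    case True
    then have "v$2 \<noteq> 0" using v by (auto simp: vec_eq_iff forall_2)
    then show ?thesis using True e
      by (intro that[of "mat2 (v$1) 1 (v$2) 0" "g$2$1 / v$2" "g$1$1"])
         (simp_all add: invertible_mat2_iff mat2_eq_iff mat2_mult_nth mult.commute)
  next
    case False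
    then show ?thesis using e
      by (intro that[of "mat2 (v$1) 0 (v$2) 1" "g$1$2 / v$1" "g$2$2 - v$2 * (g$1$2 / v$1)"])
         (simp_all add: invertible_mat2_iff mat2_eq_iff mat2_mult_nth mult.commute)
  qed
qed

text \<open>For equal eigenvalues the corner entry of the \<open>m\<close>-th power is
  \<open>m * b ^ (m - 1) * x\<close>, and its vanishing forces \<open>x = 0\<close> because
  \<open>m\<close> is nonzero in the field. Distinct eigenvalues need only a change of
  basis.\<close>

lemma diagonalise:
  fixes g :: "'a::{finite,field} ^ 2 ^ 2"
  assumes g: "invertible g" "matpow g m = mat 1"
    and v: "v \<noteq> 0" "g *v v = c *s v"
    and m: "m > 0" "(of_nat m :: 'a) \<noteq> 0"
  obtains P a b where "invertible P" "P ** g ** matrix_inv P = diag2 a b" "a ^ m = 1" "b ^ m = 1"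
proof -
  obtain Q x b where Q: "invertible Q" "g ** Q = Q ** mat2 c x 0 b"
    using triangularise[OF v] .
  \<comment> \<open>Used twice: on the triangular form to kill the corner, and on the diagonal form
    to obtain roots of unity.\<close>
  have pow: "matpow B m = mat 1" if "invertible U" "g ** U = U ** B" for U B
  proof -
    have "matrix_inv U ** g ** matrix_inv (matrix_inv U) = B"
    proof (subst matrix_conj_eq_iff)
      show "invertible (matrix_inv U)" using that(1) by (rule invertible_matrix_inv)
      show "matrix_inv U ** g = B ** matrix_inv U"
        using that matrix_inv_cancel[OF that(1)] by (metis matrix_mul_assoc)
    qed
    then have "matpow B m = matrix_inv U ** mat 1 ** matrix_inv (matrix_inv U)"
      using matpow_conj[OF invertible_matrix_inv[OF that(1)]] g(2) by metis
    then show ?thesis using invertible_matrix_inv[OF that(1)] by (simp add: matrix_inv_mult)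
  qed
  have "\<exists>U a. invertible U \<and> g ** U = U ** diag2 a b"
  proof (cases "c = b")
    case True
    then have "matpow (mat2 b x 0 b) m = mat 1" using pow[OF Q] by simp
    then have "b ^ m = 1" "of_nat m * b ^ (m - 1) * x = 0"
      by (simp_all add: matpow_jordan mat2_one mat2_eq_iff)
    moreover from this have "b \<noteq> 0" using m(1) by (auto simp: power_0_left)
    ultimately have "x = 0" using m(2) by simp
    then show ?thesis using Q True by blast
  next
    case False
    \<comment> \<open>The second column is an eigenvector of the triangular matrix for
      \<open>b\<close>.\<close>
    let ?U = "mat2 1 (x / (b - c)) 0 1"
    have "mat2 c x 0 b ** ?U = ?U ** diag2 c b"
      using False by (simp add: mat2_eq_iff mat2_mult_nth field_simps)
    then have "g ** (Q ** ?U) = (Q ** ?U) ** diag2 c b"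
      using Q(2) by (metis matrix_mul_assoc)
    moreover have "invertible (Q ** ?U)"
      using Q(1) by (intro invertible_mult) (simp_all add: invertible_mat2_iff)
    ultimately show ?thesis by blast
  qed
  then obtain U a where U: "invertible U" "g ** U = U ** diag2 a b" by blast
  from pow[OF this] have "a ^ m = 1" "b ^ m = 1"
    by (simp_all add: matpow_diag2 mat2_one diag2_eq_iff)
  moreover have "matrix_inv U ** g ** matrix_inv (matrix_inv U) = diag2 a b"
    using U matrix_inv_cancel[OF U(1)]
    by (subst matrix_conj_eq_iff[OF invertible_matrix_inv]) (metis matrix_mul_assoc)+
  ultimately show ?thesis using that invertible_matrix_inv[OF U(1)] by blast
qed

text \<open>Each nonzero entry of \<open>P\<close> equates an old eigenvalue with a new one; a
  nonzero determinant supplies two such entries on the diagonal or two off it.\<close>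

lemma diag2_conj_cases:
  fixes P :: "'a::field ^ 2 ^ 2"
  assumes "invertible P" "P ** diag2 a b ** matrix_inv P = diag2 c d"
  shows "(c = a \<and> d = b) \<or> (c = b \<and> d = a)"
proof -
  have "P ** diag2 a b = diag2 c d ** P" using assms matrix_conj_eq_iff by blast
  then have "P$1$1 * a = c * P$1$1" "P$1$2 * b = c * P$1$2" "P$2$1 * a = d * P$2$1" "P$2$2 * b = d * P$2$2"
    by (simp_all add: mat2_eq_iff mat2_mult_nth)
  moreover have "(P$1$1 \<noteq> 0 \<and> P$2$2 \<noteq> 0) \<or> (P$1$2 \<noteq> 0 \<and> P$2$1 \<noteq> 0)"
    using assms(1) by (auto simp: invertible_mat2_iff)
  ultimately show ?thesis by auto
qed

section \<open>Conjugacy and reducibility of diagonal cyclic groups\<close>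

lemma conj_cyc_diag2_swap: "conj_GL2 (cyc (diag2 a b)) (cyc (diag2 b a))"
proof -
  let ?P = "mat2 0 1 1 0 :: 'a ^ 2 ^ 2"
  have P: "invertible ?P" by (simp add: invertible_mat2_iff)
  have "?P ** diag2 a b ** matrix_inv ?P = diag2 b a"
    unfolding matrix_conj_eq_iff[OF P] by (simp add: mat2_eq_iff mat2_mult_nth)
  then show ?thesis unfolding conj_GL2_def
    using P cyc_conj[OF P, of "diag2 a b"] by (intro bexI[of _ ?P]) (auto simp: GL2_def)
qed

text \<open>The conjugated generator lies in a group of diagonal matrices, hence is diagonal, and so
  is the old generator up to exchanging its eigenvalues.\<close>

lemma conj_cyc_diag2_iff:
  "conj_GL2 (cyc (diag2 a b)) (cyc (diag2 c d))
    \<longleftrightarrow> cyc (diag2 c d) = cyc (diag2 a b) \<or> cyc (diag2 c d) = cyc (diag2 b a)"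
proof
  assume "conj_GL2 (cyc (diag2 a b)) (cyc (diag2 c d))"
  then obtain P where P: "invertible P"
    and eq: "cyc (diag2 c d) = cyc (P ** diag2 a b ** matrix_inv P)"
    by (auto simp: conj_GL2_def GL2_def cyc_conj)
  then have "P ** diag2 a b ** matrix_inv P \<in> cyc (diag2 c d)" using mem_cyc_self by metis
  then obtain n where n: "P ** diag2 a b ** matrix_inv P = diag2 (c ^ n) (d ^ n)"
    by (auto simp: cyc_eq_range matpow_diag2)
  from diag2_conj_cases[OF P n] eq n
  show "cyc (diag2 c d) = cyc (diag2 a b) \<or> cyc (diag2 c d) = cyc (diag2 b a)" by auto
qed (metis conj_GL2_refl conj_cyc_diag2_swap)

lemma reducible_conj:
  assumes "reducible H" "conj_GL2 H K"
  shows "reducible K"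
proof -
  obtain v where v: "v \<noteq> 0" "\<And>h. h \<in> H \<Longrightarrow> \<exists>c. h *v v = c *s v"
    using assms(1) by (auto simp: reducible_def)
  obtain P where P: "invertible P" "K = (\<lambda>A. P ** A ** matrix_inv P) ` H"
    using assms by (auto simp: conj_GL2_def GL2_def)
  have cancel: "matrix_inv P *v (P *v v) = v"
    by (simp add: matrix_vector_mul_assoc matrix_inv_mult[OF P(1)])
  then have "P *v v \<noteq> 0" using v(1) by auto
  moreover have "\<exists>c. h *v (P *v v) = c *s (P *v v)" if "h \<in> K" for h
  proof -
    obtain A where A: "A \<in> H" "h = P ** A ** matrix_inv P" using \<open>h \<in> K\<close> P(2) by blast
    have "h *v (P *v v) = P *v (A *v v)"
      using cancel by (simp add: A(2) matrix_vector_mul_assoc[symmetric])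
    moreover obtain c where "A *v v = c *s v" using v(2) A(1) by blast
    ultimately show ?thesis by (metis vector_scalar_commute)
  qed
  ultimately show ?thesis unfolding reducible_def by blast
qed

lemma reducible_cyc_diag2: "reducible (cyc (diag2 a b))"
  unfolding reducible_def
proof (intro exI[of _ "vector [1, 0]"] conjI ballI)
  show "(vector [1, 0] :: 'a ^ 2) \<noteq> 0" by (simp add: vec_eq_iff forall_2)
  fix h assume "h \<in> cyc (diag2 a b)"
  then obtain n where "h = diag2 (a ^ n) (b ^ n)" by (auto simp: cyc_eq_range matpow_diag2)
  then show "\<exists>c. h *v vector [1, 0] = c *s vector [1, 0]"
    by (intro exI[of _ "a ^ n"]) (simp add: vec_eq_iff forall_2 matrix_vector_mult_def sum_2)
qed

section \<open>The number of conjugacy classes\<close>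

theorem theoremA:
  fixes p k m :: nat
  assumes "prime p" and "k \<ge> 1" and "CARD('a::{finite,field}) = p ^ k"
    and "m > 0" and "m dvd CARD('a) - 1"
  shows "real (N_classes TYPE('a) m) = (real (rho m) + real (delta m)) / 2"
proof -
  obtain w :: 'a where w: "w \<noteq> 0" "\<And>i j. w ^ i = w ^ j \<longleftrightarrow> [i = j] (mod m)"
    "\<And>a. a ^ m = 1 \<Longrightarrow> \<exists>i<m. a = w ^ i"
    using primitive_root_of_unity[OF assms(4,5)] by blast
  define D where "D x = diag2 (w ^ fst x) (w ^ snd x)" for x :: "nat \<times> nat"
  let ?Q = "{..<m} \<times> {..<m}"
  let ?A = "red_cyc_subgroups m :: ('a ^ 2 ^ 2) set set"
  define r where "r = {(H, K). H \<in> ?A \<and> K \<in> ?A \<and> conj_GL2 H K}"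
  define X where "X = image D ` orbit m ` prim_pairs m"
  \<comment> \<open>Reading matrix entries defines the swap without choosing exponents or a
    generator.\<close>
  define s where "s H = (\<lambda>A :: 'a ^ 2 ^ 2. diag2 (A$2$2) (A$1$1)) ` H" for H

  have inj: "inj_on D ?Q"
    by (rule inj_onI) (auto simp: D_def diag2_eq_iff w(2) dest: cong_less_modulus_unique_nat)
  have D_orbit: "D ` orbit m x = cyc (D x)" for x
  proof -
    have "D (scale_pair m n x) = matpow (D x) n" for n
      by (simp add: D_def scale_pair_def matpow_diag2 diag2_eq_iff power_mult[symmetric] w(2) cong_def mult.commute)
    then show ?thesis by (simp add: orbit_def cyc_eq_range image_image)
  qed
  have D_inv: "invertible (D x)" for x using w(1) by (simp add: D_def invertible_mat2_iff)
  have card_D: "card (D ` c) = card c" if "c \<subseteq> ?Q" for c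
    using inj that by (meson card_image inj_on_subset)
  have orbits: "c \<subseteq> ?Q" if "c \<in> orbit m ` prim_pairs m" for c
    using that orbit_subset[OF assms(4)] by blast
  have inj_image: "inj_on (image D) (orbit m ` prim_pairs m)"
    using inj_on_image_eq_iff[OF inj] orbits by (auto intro!: inj_onI)
  have s_D: "s (D ` c) = D ` prod.swap ` c" for c
    by (simp add: s_def D_def image_image)

  \<comment> \<open>\<open>D\<close> is injective on reduced pairs, so the matrix group and the
    orbit have the same size.\<close>
  have mem_A: "cyc (D x) \<in> ?A \<longleftrightarrow> x \<in> prim_pairs m" if "x \<in> ?Q" for x
  proof -
    have "card (cyc (D x)) = card (orbit m x)"
      unfolding D_orbit[symmetric] using orbit_subset[OF assms(4)] by (rule card_D)
    moreover have "reducible (cyc (D x))" unfolding D_def by (rule reducible_cyc_diag2)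
    moreover have "cyclic_subgroup_GL2 (cyc (D x))"
      unfolding cyclic_subgroup_GL2_def GL2_def using D_inv by blast
    ultimately show ?thesis
      using card_orbit_eq_iff[OF assms(4) that] by (simp add: red_cyc_subgroups_def)
  qed
  have "equiv ?A r"
    by (rule equivI)
       (auto simp: r_def refl_on_def sym_def trans_def conj_GL2_refl intro: conj_GL2_sym conj_GL2_trans)
  moreover have "finite X" by (simp add: X_def)
  moreover have "X \<subseteq> ?A"
    using mem_A prim_pairs_subset by (fastforce simp: X_def D_orbit)
  \<comment> \<open>Diagonalising a generator gives \<open>m\<close>-th roots of unity as
    eigenvalues, hence exponents of \<open>w\<close>; the order, preserved by conjugation, makes the
    pair primitive.\<close>
  moreover have "\<exists>K\<in>X. (H, K) \<in> r" if H: "H \<in> ?A" for H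
  proof -
    obtain g where g: "invertible g" "H = cyc g" "card (cyc g) = m"
      using H by (auto simp: red_cyc_subgroups_def cyclic_subgroup_GL2_def GL2_def)
    obtain v c where v: "v \<noteq> 0" "g *v v = c *s v"
      using H g(2) mem_cyc_self[of g] by (auto simp: red_cyc_subgroups_def reducible_def)
    have "matpow g m = mat 1" using matpow_card_cyc[OF g(1)] g(3) by simp
    from diagonalise[OF g(1) this v assms(4) of_nat_dvd_card_minus_one_nonzero[OF assms(5)]]
    obtain P a b where P: "invertible P" "P ** g ** matrix_inv P = diag2 a b" "a ^ m = 1" "b ^ m = 1" .
    obtain i j where ij: "i < m" "j < m" "a = w ^ i" "b = w ^ j" using w(3) P(3,4) by blast
    have K: "cyc (D (i, j)) = (\<lambda>A. P ** A ** matrix_inv P) ` H"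
      using cyc_conj[OF P(1), of g] by (simp add: D_def g(2) P(2) ij)
    then have conj: "conj_GL2 H (cyc (D (i, j)))" using P(1) by (auto simp: conj_GL2_def GL2_def)
    have "card (cyc (D (i, j))) = card H"
      unfolding K using matrix_conj_inj[OF P(1)] by (meson card_image inj_on_subset subset_UNIV)
    moreover have "cyclic_subgroup_GL2 (cyc (D (i, j)))"
      unfolding cyclic_subgroup_GL2_def GL2_def using D_inv by blast
    ultimately have "cyc (D (i, j)) \<in> ?A"
      using H conj reducible_conj unfolding red_cyc_subgroups_def by auto
    moreover from this have "(i, j) \<in> prim_pairs m" using mem_A ij(1,2) by simp
    then have "cyc (D (i, j)) \<in> X" unfolding X_def D_orbit[symmetric] by blast
    ultimately show ?thesis using H conj by (auto simp: r_def)
  qed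
  moreover have "s H \<in> X" "s (s H) = H" if "H \<in> X" for H
  proof -
    obtain x where x: "x \<in> prim_pairs m" "H = D ` orbit m x" using \<open>H \<in> X\<close> by (auto simp: X_def)
    show "s H \<in> X" unfolding x(2) s_D swap_orbit X_def using x(1) swap_mem_prim_pairs by blast
    show "s (s H) = H" unfolding x(2) s_D by (simp add: image_image)
  qed
  moreover have "(H, K) \<in> r \<longleftrightarrow> K = H \<or> K = s H" if "H \<in> X" "K \<in> X" for H K
  proof -
    obtain x where x: "H = D ` orbit m x" using \<open>H \<in> X\<close> by (auto simp: X_def)
    obtain y where y: "K = D ` orbit m y" using \<open>K \<in> X\<close> by (auto simp: X_def)
    have "(H, K) \<in> r \<longleftrightarrow> conj_GL2 H K" using that \<open>X \<subseteq> ?A\<close> by (auto simp: r_def)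
    moreover have "s H = cyc (D (prod.swap x))" unfolding x s_D swap_orbit by (rule D_orbit)
    ultimately show ?thesis
      unfolding x y D_orbit using conj_cyc_diag2_iff by (simp add: D_def)
  qed
  ultimately have "2 * card (?A // r) = card X + card {H \<in> X. s H = H}"
    by (rule card_quotient_involution)
  moreover have "card X = rho m"
    using inj_image by (simp add: X_def card_image card_orbits[OF assms(4)])
  moreover have "card {H \<in> X. s H = H} = delta m"
  proof -
    \<comment> \<open>Both \<open>c\<close> and its swap consist of reduced pairs, so injectivity of
      \<open>D\<close> carries the fixed-point condition over.\<close>
    have "s (D ` c) = D ` c \<longleftrightarrow> prod.swap ` c = c" if "c \<in> orbit m ` prim_pairs m" for c
    proof -
      have "prod.swap ` c \<subseteq> prod.swap ` ?Q" using orbits[OF that] by (rule image_mono)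
      also have "\<dots> = ?Q" by (rule product_swap)
      finally show ?thesis unfolding s_D using inj_on_image_eq_iff[OF inj] orbits[OF that] by simp
    qed
    then have "{H \<in> X. s H = H} = image D ` {c \<in> orbit m ` prim_pairs m. prod.swap ` c = c}"
      unfolding X_def by blast
    moreover have "inj_on (image D) {c \<in> orbit m ` prim_pairs m. prod.swap ` c = c}"
      using inj_image by (rule inj_on_subset) blast
    ultimately show ?thesis
      by (simp add: card_image card_swap_fixed_orbits card_sqrt_one assms(4))
  qed
  ultimately have "2 * N_classes TYPE('a) m = rho m + delta m"
    by (simp add: N_classes_def r_def)
  then have "real (2 * N_classes TYPE('a) m) = real (rho m + delta m)" by (simp only:)
  then show ?thesis by simp
qed

end
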